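(* Consider the problem $\min_{x\in\operatorname{dom}\Psi}[\tilde f(x)=f(x)+\Psi(x)]$, where $f$ is convex with $\operatorname{dom} f=\mathbb{E}$ and satisfies the Regularity Assumption, and $\Psi$ is a closed convex function; let $x^*$ be an optimal solution. Let $\{x_k\}$, $\{y_k\}$, $\{L_k\}$, $\{\phi_k\}$ be generated by the method DGM (described in the context) with accuracy $\epsilon>0$ and $0<L_0\le\gamma_f(\epsilon)$. Denote $$S_k=\sum_{i=0}^k\frac1{L_{i+1}},\qquad\tilde f_k^*=\frac1{S_k}\sum_{i=0}^k\frac1{L_{i+1}}\tilde f(y_i),\qquad\phi_k^*=\min_{y\in\operatorname{dom}\Psi}\phi_k(y)=\phi_k(x_k).$$ Then for all $k\ge0$ we have $L_k\le\gamma_f(\epsilon)$. Moreover, for all $k\ge0$, $$\sum_{i=0}^k\frac1{2L_{i+1}}\tilde f(y_i)\ \le\ \phi_{k+1}^*+S_k\cdot\frac\epsilon4.$$ Therefore, for all $k\ge 0$, $$\tilde f_k^*-\tilde f(x^* )\ \le\ \frac\epsilon2+\frac{2\gamma_f(\epsilon)}{k+1}\,\beta_d(x_0,x^* ).$$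
   Context: $\mathbb{E}$ is a finite-dimensional real linear space with dual $\mathbb{E}^*$; $\langle g,x\rangle$ is the value of $g\in\mathbb{E}^*$ at $x$; $\|\cdot\|$ is an arbitrary fixed norm on $\mathbb{E}$. $f:\mathbb{E}\to\mathbb{R}$ is convex and not affine; $\nabla f(x)\in\partial f(x)$ is its gradient (subgradient). $\Psi$ is closed convex with $\operatorname{dom}\Psi\subseteq\mathbb{E}$, $\operatorname{int}(\operatorname{dom}\Psi)\ne\emptyset$. Global Curvature Bound: $\hat\mu(t)=\sup\big\{\frac{\alpha f(x)+(1-\alpha)f(y)-f(\alpha x+(1-\alpha)y)}{\alpha(1-\alpha)}:\ x,y\in\mathbb{E},\ \alpha\in(0,1),\ \|x-y\|\le t\big\}$, $t\ge0$. Regularity Assumption: $\hat\mu(t)<+\infty$ for all $t\ge0$ and $\lim_{\tau\to+0}\frac1\tau\hat\mu(\tau)=0$. The complexity gauge $s_f$ is the inverse function of $\hat\mu$: $\hat\mu(s_f(\epsilon))=\epsilon$, $\epsilon\ge0$. For $t>0$: $\gamma_f(t)=t/s_f^2(t/2)$. Prox-function: $d$ is a differentiable convex function on $\operatorname{dom}\Psi$ with $d(y)\ge d(x)+\langle\nabla d(x),y-x\rangle+\frac12\|y-x\|^2$ for $x\in\operatorname{int}(\operatorname{dom}\Psi)$, $y\in\operatorname{dom}\Psi$; $x_0=\operatorname{arg\,min}_{x\in\operatorname{dom}\Psi}d(x)$ and $d(x_0)=0$. Bregman distance: $\beta_d(x,y)=d(y)-d(x)-\langle\nabla d(x),y-x\rangle$.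 Let $\psi_M(x,y)=f(x)+\langle\nabla f(x),y-x\rangle+M\beta_d(x,y)+\Psi(y)$, $\mathcal{B}_M(x)=\operatorname{arg\,min}_{y\in\operatorname{dom}\Psi}\psi_M(x,y)$ (assumed to be computable), and $\psi_M^*(x)=\psi_M(x,\mathcal{B}_M(x))$. Universal Dual Gradient Method (DGM). Start from $x_0$ above; choose $L_0>0$, $\epsilon>0$; set $\phi_0(x)=\beta_d(x_0,x)$. For $k\ge0$ do: 1. Find the smallest integer $i_k\ge0$ such that for the point $x_{k,i_k}=\operatorname{arg\,min}_{x\in\operatorname{dom}\Psi}\big\{\phi_k(x)+\frac1{2^{i_k}L_k}[f(x_k)+\langle\nabla f(x_k),x-x_k\rangle+\Psi(x)]\big\}$ we have $\tilde f(\mathcal{B}_{2^{i_k}L_k}(x_{k,i_k}))\le\psi^*_{2^{i_k}L_k}(x_{k,i_k})+\frac\epsilon2$. 2. Set $x_{k+1}=x_{k,i_k}$, $y_k=\mathcal{B}_{2^{i_k}L_k}(x_{k,i_k})$, $L_{k+1}=2^{i_k-1}L_k$, and $\phi_{k+1}(x)=\phi_k(x)+\frac1{2L_{k+1}}[f(x_k)+\langle\nabla f(x_k),x-x_k\rangle+\Psi(x)]$.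
   Formalization: The method is corrected: the line-search test and the output y_k are taken at x_k (f̃(B_M(x_k)) ≤ ψ*_M(x_k)+ε/2, y_k = B_M(x_k), M = 2^{i_k}L_k) instead of at x_{k,i_k}; as printed, the second and third claims fail. *)

theory Defs
  imports "HOL-Analysis.Analysis"
begin

text \<open>
  The space \<open>\<bbbE>\<close> is a finite-dimensional type of class \<^class>\<open>real_normed_vector\<close>, so its norm is
  arbitrary and need not come from an inner product. Every linear functional on such a space is
  bounded, hence the dual is \<^typ>\<open>'a \<Rightarrow>\<^sub>L real\<close>. An extended-valued function \<open>\<Psi>\<close> is represented by
  its effective domain \<open>Q\<close> together with a real function whose values matter only on \<open>Q\<close>.
\<close>

definition finite_dimensional :: "'a::real_vector itself \<Rightarrow> bool" where
  "finite_dimensional _ \<longleftrightarrow> (\<exists>B :: 'a set. finite B \<and> span B = UNIV)"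

definition affine_function :: "('a::real_vector \<Rightarrow> real) \<Rightarrow> bool" where
  "affine_function f \<longleftrightarrow> (\<exists>g c. linear g \<and> (\<forall>x. f x = g x + c))"

definition subdifferential ::
    "('a::real_normed_vector \<Rightarrow> real) \<Rightarrow> 'a \<Rightarrow> ('a \<Rightarrow>\<^sub>L real) set" where
  "subdifferential f x = {g. \<forall>y. f y \<ge> f x + blinfun_apply g (y - x)}"

text \<open>Closedness is closedness of the epigraph; \<open>Q\<close> itself need not be closed.\<close>

definition closed_convex_function :: "'a::real_normed_vector set \<Rightarrow> ('a \<Rightarrow> real) \<Rightarrow> bool" where
  "closed_convex_function Q \<Psi> \<longleftrightarrow> convex_on Q \<Psi> \<and> closed (epigraph Q \<Psi>)"

definition curvature_bound :: "('a::real_normed_vector \<Rightarrow> real) \<Rightarrow> real \<Rightarrow> ereal" where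
  "curvature_bound f t =
     Sup {ereal ((\<alpha> * f x + (1 - \<alpha>) * f y - f (\<alpha> *\<^sub>R x + (1 - \<alpha>) *\<^sub>R y)) / (\<alpha> * (1 - \<alpha>))) | x y \<alpha>.
          0 < \<alpha> \<and> \<alpha> < 1 \<and> norm (x - y) \<le> t}"

definition curvature_regular :: "('a::real_normed_vector \<Rightarrow> real) \<Rightarrow> bool" where
  "curvature_regular f \<longleftrightarrow>
     (\<forall>t\<ge>0. curvature_bound f t < \<infinity>) \<and>
     ((\<lambda>\<tau>. ereal (1 / \<tau>) * curvature_bound f \<tau>) \<longlongrightarrow> 0) (at_right 0)"

text \<open>The inverse function of \<^const>\<open>curvature_bound\<close> on the nonnegative half-line.\<close>

definition complexity_gauge :: "('a::real_normed_vector \<Rightarrow> real) \<Rightarrow> real \<Rightarrow> real" where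
  "complexity_gauge f \<epsilon> = inv_into {0..} (curvature_bound f) (ereal \<epsilon>)"

definition gamma_gauge :: "('a::real_normed_vector \<Rightarrow> real) \<Rightarrow> real \<Rightarrow> real" where
  "gamma_gauge f t = t / (complexity_gauge f (t / 2))\<^sup>2"

text \<open>
  Differentiability on \<open>Q\<close> is differentiability within \<open>Q\<close> at every point of \<open>Q\<close>, boundary points
  included: the method uses \<open>\<nabla>d\<close> at its iterates, which may lie on the boundary. As \<open>Q\<close> is convex
  with nonempty interior, this derivative is unique.
\<close>

definition prox_function ::
    "'a::real_normed_vector set \<Rightarrow> ('a \<Rightarrow> real) \<Rightarrow> ('a \<Rightarrow> 'a \<Rightarrow>\<^sub>L real) \<Rightarrow> bool" where
  "prox_function Q d d' \<longleftrightarrow>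
     convex_on Q d \<and>
     (\<forall>x\<in>Q. (d has_derivative blinfun_apply (d' x)) (at x within Q)) \<and>
     (\<forall>x\<in>interior Q. \<forall>y\<in>Q.
        d y \<ge> d x + blinfun_apply (d' x) (y - x) + 1/2 * (norm (y - x))\<^sup>2)"

definition bregman ::
    "('a::real_normed_vector \<Rightarrow> real) \<Rightarrow> ('a \<Rightarrow> 'a \<Rightarrow>\<^sub>L real) \<Rightarrow> 'a \<Rightarrow> 'a \<Rightarrow> real" where
  "bregman d d' x y = d y - d x - blinfun_apply (d' x) (y - x)"

definition linear_model ::
    "('a::real_normed_vector \<Rightarrow> real) \<Rightarrow> ('a \<Rightarrow> 'a \<Rightarrow>\<^sub>L real) \<Rightarrow> ('a \<Rightarrow> real) \<Rightarrow> 'a \<Rightarrow> 'a \<Rightarrow> real" where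
  "linear_model f f' \<Psi> x y = f x + blinfun_apply (f' x) (y - x) + \<Psi> y"

definition psi_model ::
    "('a::real_normed_vector \<Rightarrow> real) \<Rightarrow> ('a \<Rightarrow> 'a \<Rightarrow>\<^sub>L real) \<Rightarrow> ('a \<Rightarrow> real) \<Rightarrow>
     ('a \<Rightarrow> real) \<Rightarrow> ('a \<Rightarrow> 'a \<Rightarrow>\<^sub>L real) \<Rightarrow> real \<Rightarrow> 'a \<Rightarrow> 'a \<Rightarrow> real" where
  "psi_model f f' \<Psi> d d' M x y =
     f x + blinfun_apply (f' x) (y - x) + M * bregman d d' x y + \<Psi> y"

definition bregman_step ::
    "('a::real_normed_vector \<Rightarrow> real) \<Rightarrow> ('a \<Rightarrow> 'a \<Rightarrow>\<^sub>L real) \<Rightarrow> 'a set \<Rightarrow> ('a \<Rightarrow> real) \<Rightarrow>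
     ('a \<Rightarrow> real) \<Rightarrow> ('a \<Rightarrow> 'a \<Rightarrow>\<^sub>L real) \<Rightarrow> real \<Rightarrow> 'a \<Rightarrow> 'a" where
  "bregman_step f f' Q \<Psi> d d' M x = arg_min (psi_model f f' \<Psi> d d' M x) (\<lambda>y. y \<in> Q)"

definition psi_star ::
    "('a::real_normed_vector \<Rightarrow> real) \<Rightarrow> ('a \<Rightarrow> 'a \<Rightarrow>\<^sub>L real) \<Rightarrow> 'a set \<Rightarrow> ('a \<Rightarrow> real) \<Rightarrow>
     ('a \<Rightarrow> real) \<Rightarrow> ('a \<Rightarrow> 'a \<Rightarrow>\<^sub>L real) \<Rightarrow> real \<Rightarrow> 'a \<Rightarrow> real" where
  "psi_star f f' Q \<Psi> d d' M x =
     psi_model f f' \<Psi> d d' M x (bregman_step f f' Q \<Psi> d d' M x)"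

definition line_search_test ::
    "('a::real_normed_vector \<Rightarrow> real) \<Rightarrow> ('a \<Rightarrow> 'a \<Rightarrow>\<^sub>L real) \<Rightarrow> 'a set \<Rightarrow> ('a \<Rightarrow> real) \<Rightarrow>
     ('a \<Rightarrow> real) \<Rightarrow> ('a \<Rightarrow> 'a \<Rightarrow>\<^sub>L real) \<Rightarrow> real \<Rightarrow> real \<Rightarrow> 'a \<Rightarrow> bool" where
  "line_search_test f f' Q \<Psi> d d' \<epsilon> M z \<longleftrightarrow>
     (let y = bregman_step f f' Q \<Psi> d d' M z
      in f y + \<Psi> y \<le> psi_star f f' Q \<Psi> d d' M z + \<epsilon> / 2)"

text \<open>
  Sequences generated by the universal dual gradient method. The existence of an exponent passing
  the test is not part of the definition; hence \<^term>\<open>Least\<close>.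

  Pitfall: the test and the output \<open>y k\<close> are taken at the point \<open>x k\<close> at which \<open>f\<close> is linearised in
  the update of \<open>\<phi>\<close>. If they are taken instead at the trial point \<open>x (Suc k)\<close>, the estimates
  for \<open>\<Sum>i\<le>k. (f (y i) + \<Psi> (y i)) / (2 * L (Suc i))\<close> and for the averaged objective fail:
  on the real line let \<open>\<Psi> = 0\<close>, \<open>d z = z\<^sup>2/2\<close>, \<open>f z = (max 0 (1 - z))\<^sup>2/2 + z/4\<close>, \<open>\<epsilon> = 1/10\<close>,
  \<open>L 0 = 1/100\<close>; then \<open>gamma_gauge f \<epsilon> = 1\<close> and the test at the trial point \<open>x 1 = 75\<close>
  accepts \<open>i 0 = 0\<close>, but \<open>y 0 = 50\<close> and \<open>f (y 0) = 25/2\<close> violate both estimates for \<open>k = 0\<close>.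
\<close>

definition dgm_run ::
    "('a::real_normed_vector \<Rightarrow> real) \<Rightarrow> ('a \<Rightarrow> 'a \<Rightarrow>\<^sub>L real) \<Rightarrow> 'a set \<Rightarrow> ('a \<Rightarrow> real) \<Rightarrow>
     ('a \<Rightarrow> real) \<Rightarrow> ('a \<Rightarrow> 'a \<Rightarrow>\<^sub>L real) \<Rightarrow> real \<Rightarrow> real \<Rightarrow> 'a \<Rightarrow>
     (nat \<Rightarrow> 'a) \<Rightarrow> (nat \<Rightarrow> 'a) \<Rightarrow> (nat \<Rightarrow> real) \<Rightarrow> (nat \<Rightarrow> 'a \<Rightarrow> real) \<Rightarrow> (nat \<Rightarrow> nat) \<Rightarrow> bool" where
  "dgm_run f f' Q \<Psi> d d' \<epsilon> L0 x0 x y L \<phi> i \<longleftrightarrow>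
     x 0 = x0 \<and> L 0 = L0 \<and> \<phi> 0 = bregman d d' x0 \<and>
     (\<forall>k. i k = (LEAST j. line_search_test f f' Q \<Psi> d d' \<epsilon> (2 ^ j * L k) (x k)) \<and>
          is_arg_min (\<lambda>z. \<phi> k z + 1 / (2 ^ i k * L k) * linear_model f f' \<Psi> (x k) z)
            (\<lambda>z. z \<in> Q) (x (Suc k)) \<and>
          y k = bregman_step f f' Q \<Psi> d d' (2 ^ i k * L k) (x k) \<and>
          L (Suc k) = 2 ^ i k * L k / 2 \<and>
          \<phi> (Suc k) = (\<lambda>z. \<phi> k z + 1 / (2 * L (Suc k)) * linear_model f f' \<Psi> (x k) z))"

end

theory Submission
  imports Defs
begin

text \<open>
  The argument combines a uniform upper model of \<open>f\<close> with the minimisation of an accumulated lower model.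

  The upper model says that, whatever the smoothness of \<open>f\<close>, its linearisation at any point plus
  the quadratic term with coefficient \<open>gamma_gauge f \<epsilon> / 2\<close> dominates \<open>f\<close> up to an error of \<open>\<epsilon> / 2\<close>
  (\<open>inexact_quadratic_upper_bound\<close>). It rests on two facts. The curvature bound at distance \<open>t\<close> dominates
  the error of linearising \<open>f\<close> over that distance (\<open>subgradient_upper_bound\<close>), and it grows at most
  quadratically in \<open>t\<close> (\<open>gap_within_scale\<close>), so its value at the single distance where it equals \<open>\<epsilon> / 2\<close>
  controls it at all distances. Such a distance exists because the bound is continuous, vanishes at the
  origin, and is unbounded for a function that is not affine (\<open>complexity_gauge_inverse\<close>).

  As Bregman distances dominate half of the squared norm, also from base points on the boundary
  (\<open>prox_function_bregman_lower_bound\<close>), the line search accepts every constant at or above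
  \<open>gamma_gauge f \<epsilon>\<close>. This keeps all \<open>L k\<close> below that value.

  The potential \<open>\<phi> k\<close> is the Bregman distance from \<open>x0\<close> plus a weighted sum of linear models, which are
  lower bounds of the objective. Its minimum increases at each step by at least the weighted objective
  value at \<open>y k\<close>, up to the tolerance (\<open>potential_step\<close>): away from its minimiser \<open>x k\<close> the potential grows
  at least as fast as the Bregman distance (\<open>potential_growth\<close>), so the updated potential dominates the model
  that \<open>y k\<close> minimises. Summation bounds the objective values by the minimum of the potential. Evaluating
  the potential at an optimal point and dividing by \<open>S k \<ge> (k + 1) / gamma_gauge f \<epsilon>\<close> gives the rate.
\<close>

section \<open>Growth and continuity of the curvature bound\<close>

text \<open>
  This is \<open>curvature_bound f t \<le> m\<close> with the supremum and the division cleared away. The curvature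
  estimates are statements about upper bounds of the supremum, so real arithmetic suffices for them.
\<close>

definition gap_within :: "('a::real_normed_vector \<Rightarrow> real) \<Rightarrow> real \<Rightarrow> real \<Rightarrow> bool" where
  "gap_within f t m \<longleftrightarrow> (\<forall>x y \<alpha>. 0 < \<alpha> \<longrightarrow> \<alpha> < 1 \<longrightarrow> norm (x - y) \<le> t \<longrightarrow>
     \<alpha> * f x + (1 - \<alpha>) * f y - f (\<alpha> *\<^sub>R x + (1 - \<alpha>) *\<^sub>R y) \<le> \<alpha> * (1 - \<alpha>) * m)"

lemma gap_withinD:
  assumes "gap_within f t m" "0 < \<alpha>" "\<alpha> < 1" "norm (x - y) \<le> t"
  shows "\<alpha> * f x + (1 - \<alpha>) * f y - f (\<alpha> *\<^sub>R x + (1 - \<alpha>) *\<^sub>R y) \<le> \<alpha> * (1 - \<alpha>) * m"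
  using assms by (auto simp: gap_within_def)

lemma curvature_bound_le_iff: "curvature_bound f t \<le> ereal m \<longleftrightarrow> gap_within f t m"
proof -
  have *: "(g / (\<alpha> * (1 - \<alpha>)) \<le> m) = (g \<le> \<alpha> * (1 - \<alpha>) * m)"
    if "0 < \<alpha>" "\<alpha> < 1" for g \<alpha> :: real
    using that by (simp add: field_simps)
  show ?thesis
    unfolding curvature_bound_def gap_within_def Sup_le_iff using * by fastforce
qed

lemma curvature_bound_mono: "s \<le> t \<Longrightarrow> curvature_bound f s \<le> curvature_bound f t"
  unfolding curvature_bound_def by (rule Sup_subset_mono) force

lemma curvature_bound_0: "curvature_bound f 0 = 0"
proof -
  have "{ereal ((\<alpha> * f x + (1 - \<alpha>) * f y - f (\<alpha> *\<^sub>R x + (1 - \<alpha>) *\<^sub>R y)) / (\<alpha> * (1 - \<alpha>))) | x y \<alpha>.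
          0 < \<alpha> \<and> \<alpha> < 1 \<and> norm (x - y) \<le> 0} = {0}" (is "?S = _")
  proof
    show "?S \<subseteq> {0}"
      by (auto simp flip: scaleR_add_left distrib_right)
    have "ereal ((1/2 * f 0 + (1 - 1/2) * f 0 - f ((1/2) *\<^sub>R 0 + (1 - 1/2) *\<^sub>R 0)) / (1/2 * (1 - 1/2))) \<in> ?S"
      by (smt (verit) mem_Collect_eq norm_zero diff_self field_sum_of_halves half_gt_zero_iff zero_less_one)
    then show "{0} \<subseteq> ?S"
      by (simp flip: zero_ereal_def)
  qed
  then show ?thesis
    unfolding curvature_bound_def by simp
qed

lemma curvature_bound_nonneg: "0 \<le> t \<Longrightarrow> 0 \<le> curvature_bound f t"
  using curvature_bound_mono[of 0 t f] by (simp add: curvature_bound_0)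

text \<open>
  A minimum principle. Each \<open>u\<close> lies in the interval of length \<open>l\<close> that arises from the unit interval
  by the homothety with centre \<open>u\<close> and ratio \<open>l\<close>, and it divides that interval in the ratio \<open>u : 1 - u\<close>,
  just as it divides the unit interval. If \<open>g\<close> were negative somewhere, then at the leftmost minimiser
  the value of \<open>g\<close> would exceed a weighted mean of one value strictly above the minimum and another
  at least equal to it.
\<close>

lemma nonneg_if_dominates_homothetic_chords:
  fixes g :: "real \<Rightarrow> real"
  assumes cont: "continuous_on {0..1} g" and ends: "g 0 = 0" "g 1 = 0"
    and l: "0 < l" "l \<le> 1"
    and chord: "\<And>u. 0 < u \<Longrightarrow> u < 1 \<Longrightarrow>
      (1 - u) * g (u * (1 - l)) + u * g (u * (1 - l) + l) \<le> g u"
    and v: "v \<in> {0..1}"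
  shows "0 \<le> g v"
proof (rule ccontr)
  assume neg: "\<not> 0 \<le> g v"
  obtain w where w: "w \<in> {0..1}" "\<And>u. u \<in> {0..1} \<Longrightarrow> g w \<le> g u"
    using continuous_attains_inf[OF compact_Icc _ cont] by auto
  have "g w < 0"
    using w(2)[OF v] neg by simp
  have "{0..1} \<inter> g -` {..g w} = {u \<in> {0..1}. g u \<le> g w}"
    by auto
  moreover have "closed ({0..1} \<inter> g -` {..g w})"
    using cont by (intro continuous_closed_preimage) auto
  ultimately have "compact ({0..1} \<inter> {u \<in> {0..1}. g u \<le> g w})"
    by (intro compact_Int_closed) auto
  then have "compact {u \<in> {0..1}. g u \<le> g w}"
    by (simp add: Int_absorb1 Collect_mono subset_eq)
  moreover have "w \<in> {u \<in> {0..1}. g u \<le> g w}"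
    using w by simp
  ultimately obtain u where u: "u \<in> {0..1}" "g u \<le> g w"
    and least: "\<And>u'. u' \<in> {0..1} \<Longrightarrow> g u' \<le> g w \<Longrightarrow> u \<le> u'"
    using compact_attains_inf[of "{u \<in> {0..1}. g u \<le> g w}"] by auto
  have "u \<noteq> 0" "u \<noteq> 1"
    using u \<open>g w < 0\<close> ends by auto
  then have u01: "0 < u" "u < 1"
    using u by auto
  define p where "p = u * (1 - l)"
  have "p < u" "0 \<le> p"
    using u01 l by (auto simp: p_def)
  have "p + l = 1 - (1 - u) * (1 - l)"
    by (simp add: p_def algebra_simps)
  moreover have "0 \<le> (1 - u) * (1 - l)"
    using u01 l by simp
  ultimately have "p + l \<in> {0..1}"
    using \<open>0 \<le> p\<close> l by auto
  have "g w < g p"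
    using least[of p] \<open>p < u\<close> \<open>0 \<le> p\<close> u01 by fastforce
  then have "(1 - u) * g w < (1 - u) * g p"
    using u01 by simp
  moreover have "u * g w \<le> u * g (p + l)"
    using w(2)[OF \<open>p + l \<in> {0..1}\<close>] u01 by simp
  ultimately have "g w < (1 - u) * g p + u * g (p + l)"
    by (simp add: algebra_simps)
  also have "\<dots> \<le> g u"
    using chord[OF u01] by (simp add: p_def)
  finally show False
    using u by simp
qed

lemma convex_continuous_on_line:
  fixes f :: "'a::real_normed_vector \<Rightarrow> real"
  assumes "convex_on UNIV f"
  shows "continuous_on UNIV (\<lambda>u. f (y + u *\<^sub>R h))"
proof (rule convex_on_continuous)
  show "convex_on UNIV (\<lambda>u. f (y + u *\<^sub>R h))"
  proof (rule convex_onI)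
    fix t u v :: real
    assume "0 < t" "t < 1"
    moreover have "y + ((1 - t) *\<^sub>R u + t *\<^sub>R v) *\<^sub>R h
      = (1 - t) *\<^sub>R (y + u *\<^sub>R h) + t *\<^sub>R (y + v *\<^sub>R h)"
      by (simp add: algebra_simps)
    ultimately show "f (y + ((1 - t) *\<^sub>R u + t *\<^sub>R v) *\<^sub>R h)
      \<le> (1 - t) * f (y + u *\<^sub>R h) + t * f (y + v *\<^sub>R h)"
      using convex_onD[OF assms, of t] by simp
  qed simp
qed simp

text \<open>
  The decisive property of the curvature bound: it grows at most quadratically. On a segment of length
  at most \<open>c * s\<close>, subtract from \<open>f\<close> its chord and add \<open>c\<^sup>2 * m * u * (1 - u)\<close>. On subsegments shrunk by
  the factor \<open>1 / c\<close> the gap of \<open>f\<close> is at most \<open>m * u * (1 - u)\<close>, and the quadratic term contributes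
  exactly the same amount with the opposite sign; hence the minimum principle applies.
\<close>

lemma gap_within_scale:
  fixes f :: "'a::real_normed_vector \<Rightarrow> real"
  assumes f: "convex_on UNIV f" and gap: "gap_within f s m" and c: "1 \<le> c"
  shows "gap_within f (c * s) (c\<^sup>2 * m)"
  unfolding gap_within_def
proof (intro allI impI)
  fix x y :: 'a and \<alpha> :: real
  assume \<alpha>: "0 < \<alpha>" "\<alpha> < 1" and xy: "norm (x - y) \<le> c * s"
  define F where "F u = f (y + u *\<^sub>R (x - y))" for u
  define l where "l = 1 / c"
  have l: "0 < l" "l \<le> 1" and cl: "c * l = 1"
    using c by (auto simp: l_def)
  define g where "g u = F u - (1 - u) * F 0 - u * F 1 + c\<^sup>2 * m * (u * (1 - u))" for u
  have "0 \<le> g \<alpha>"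
  proof (rule nonneg_if_dominates_homothetic_chords[where g = g and v = \<alpha>, OF _ _ _ l])
    have "continuous_on UNIV F"
      unfolding F_def by (rule convex_continuous_on_line[OF f])
    then have "continuous_on UNIV g"
      unfolding g_def by (intro continuous_intros)
    then show "continuous_on {0..1} g"
      by (rule continuous_on_subset) simp
  next
    fix u :: real
    assume u: "0 < u" "u < 1"
    define p where "p = u * (1 - l)"
    define q where "q = p + l"
    have "(y + q *\<^sub>R (x - y)) - (y + p *\<^sub>R (x - y)) = l *\<^sub>R (x - y)"
      by (simp add: q_def scaleR_add_left)
    then have "norm ((y + q *\<^sub>R (x - y)) - (y + p *\<^sub>R (x - y))) = l * norm (x - y)"
      using l by simp
    also have "\<dots> \<le> s"
      using mult_left_mono[OF xy, of l] l cl by (simp add: algebra_simps flip: mult.assoc)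
    finally have "u * F q + (1 - u) * F p
        - f (u *\<^sub>R (y + q *\<^sub>R (x - y)) + (1 - u) *\<^sub>R (y + p *\<^sub>R (x - y))) \<le> u * (1 - u) * m"
      using gap_withinD[OF gap u] by (simp add: F_def)
    moreover have mean: "u * q + (1 - u) * p = u"
      by (simp add: p_def q_def algebra_simps)
    have "u *\<^sub>R (y + q *\<^sub>R (x - y)) + (1 - u) *\<^sub>R (y + p *\<^sub>R (x - y))
      = y + (u * q + (1 - u) * p) *\<^sub>R (x - y)"
      by (simp add: algebra_simps)
    ultimately have *: "u * F q + (1 - u) * F p - F u \<le> u * (1 - u) * m"
      by (simp add: F_def mean)
    \<comment> \<open>The concavity gap of \<open>\<lambda>u. u * (1 - u)\<close> over an interval of length \<open>l\<close>.\<close>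
    have "(1 - u) * (p * (1 - p)) + u * (q * (1 - q)) - u * (1 - u) = - (u * (1 - u)) * l\<^sup>2"
      unfolding q_def p_def by algebra
    then have "c\<^sup>2 * m * ((1 - u) * (p * (1 - p)) + u * (q * (1 - q)) - u * (1 - u))
      = - (u * (1 - u)) * m * (c * l)\<^sup>2"
      by (simp add: power_mult_distrib)
    then have "c\<^sup>2 * m * ((1 - u) * (p * (1 - p)) + u * (q * (1 - q)) - u * (1 - u))
      = - (u * (1 - u)) * m"
      by (simp add: cl)
    moreover have "(1 - u) * g p + u * g q - g u = u * F q + (1 - u) * F p - F u
      + (u - (u * q + (1 - u) * p)) * (F 1 - F 0)
      + c\<^sup>2 * m * ((1 - u) * (p * (1 - p)) + u * (q * (1 - q)) - u * (1 - u))"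
      unfolding g_def by algebra
    ultimately have "(1 - u) * g p + u * g q - g u \<le> 0"
      using * mean by simp
    then show "(1 - u) * g (u * (1 - l)) + u * g (u * (1 - l) + l) \<le> g u"
      by (simp add: p_def q_def)
  qed (use \<alpha> in \<open>auto simp: g_def\<close>)
  moreover have "y + \<alpha> *\<^sub>R (x - y) = \<alpha> *\<^sub>R x + (1 - \<alpha>) *\<^sub>R y"
    by (simp add: algebra_simps)
  ultimately show "\<alpha> * f x + (1 - \<alpha>) * f y - f (\<alpha> *\<^sub>R x + (1 - \<alpha>) *\<^sub>R y)
    \<le> \<alpha> * (1 - \<alpha>) * (c\<^sup>2 * m)"
    by (simp add: g_def F_def algebra_simps)
qed

lemma curvature_bound_scale:
  fixes f :: "'a::real_normed_vector \<Rightarrow> real"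
  assumes "convex_on UNIV f" "1 \<le> c" "curvature_bound f s \<le> ereal m"
  shows "curvature_bound f (c * s) \<le> ereal (c\<^sup>2 * m)"
  using assms gap_within_scale by (simp add: curvature_bound_le_iff)

text \<open>
  If \<open>f\<close> is not affine, it lies strictly above its supporting affine function at some point \<open>z\<close>,
  so its second difference \<open>f z + f (- z) - 2 * f 0\<close> is positive. By convexity this difference grows at
  least linearly when \<open>z\<close> is scaled up.
\<close>

lemma curvature_bound_unbounded:
  fixes f :: "'a::real_normed_vector \<Rightarrow> real"
  assumes f: "convex_on UNIV f" and "\<not> affine_function f"
    and g: "g \<in> subdifferential f 0"
  shows "\<exists>t\<ge>0. ereal v \<le> curvature_bound f t"
proof -
  have below: "f 0 + g z \<le> f z" for z
    using g by (simp add: subdifferential_def)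
  have "\<exists>z. f z \<noteq> g z + f 0"
    using \<open>\<not> affine_function f\<close> bounded_linear.linear[OF blinfun.bounded_linear_right[of g]]
    unfolding affine_function_def by blast
  then obtain z where "f 0 + g z < f z"
    using below by (metis add.commute order_le_less)
  then have "0 < f z + f (- z) - 2 * f 0"
    using below[of "- z"] by (simp add: blinfun.minus_right)
  then obtain D where D: "D = f z + f (- z) - 2 * f 0" "0 < D"
    by simp
  define c where "c = max 1 (v / D)"
  have c: "1 \<le> c" "v \<le> c * D"
    using D by (auto simp: c_def field_simps max_def)
  have ray: "c * (f w - f 0) \<le> f (c *\<^sub>R w) - f 0" for w
  proof -
    have "f ((1 - 1 / c) *\<^sub>R 0 + (1 / c) *\<^sub>R (c *\<^sub>R w)) \<le> (1 - 1 / c) * f 0 + 1 / c * f (c *\<^sub>R w)"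
      using c by (intro convex_onD[OF f]) auto
    then have "f w \<le> (1 - 1 / c) * f 0 + 1 / c * f (c *\<^sub>R w)"
      using c by simp
    then have "c * f w \<le> c * ((1 - 1 / c) * f 0 + 1 / c * f (c *\<^sub>R w))"
      using c by (intro mult_left_mono) auto
    also have "\<dots> = c * f 0 - f 0 + f (c *\<^sub>R w)"
      using c by (simp add: field_simps)
    finally show ?thesis
      by (simp add: algebra_simps)
  qed
  define t where "t = norm (c *\<^sub>R z - c *\<^sub>R (- z))"
  have "ereal v \<le> curvature_bound f t"
  proof (rule ccontr)
    assume "\<not> ereal v \<le> curvature_bound f t"
    then obtain m where m: "m < v" "curvature_bound f t \<le> ereal m"
      by (metis ereal_dense3 ereal_less_eq(3) linorder_not_le less_imp_le ereal_dense2 ereal_less(2) less_ereal.simps(1))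
    have "1/2 * f (c *\<^sub>R z) + (1 - 1/2) * f (c *\<^sub>R (- z))
        - f ((1/2) *\<^sub>R (c *\<^sub>R z) + (1 - 1/2) *\<^sub>R (c *\<^sub>R (- z))) \<le> 1/2 * (1 - 1/2) * m"
      using m(2) unfolding curvature_bound_le_iff by (rule gap_withinD) (auto simp: t_def)
    then have "2 * (f (c *\<^sub>R z) + f (c *\<^sub>R (- z)) - 2 * f 0) \<le> m"
      by simp
    moreover have "c * D \<le> f (c *\<^sub>R z) + f (c *\<^sub>R (- z)) - 2 * f 0"
      using ray[of z] ray[of "- z"] by (simp add: D algebra_simps)
    then have "2 * (c * D) \<le> 2 * (f (c *\<^sub>R z) + f (c *\<^sub>R (- z)) - 2 * f 0)"
      by (rule mult_left_mono) simp
    ultimately have "2 * (c * D) \<le> m"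
      by (rule order_trans[rotated])
    moreover have "0 < c * D"
      using c D by simp
    ultimately show False
      using c(2) m(1) by linarith
  qed
  then show ?thesis
    using norm_ge_zero t_def by blast
qed

lemma curvature_regularD:
  assumes "curvature_regular f"
  shows curvature_regular_finite: "0 \<le> t \<Longrightarrow> curvature_bound f t = ereal (real_of_ereal (curvature_bound f t))"
    and curvature_regular_sublinear:
      "0 < e \<Longrightarrow> \<forall>\<^sub>F \<tau> in at_right 0. curvature_bound f \<tau> \<le> ereal (e * \<tau>)"
proof -
  show "curvature_bound f t = ereal (real_of_ereal (curvature_bound f t))" if "0 \<le> t"
    using assms curvature_bound_nonneg[OF that, of f] that
    by (cases "curvature_bound f t") (auto simp: curvature_regular_def)
  assume "0 < e"
  have "((\<lambda>\<tau>. ereal (1 / \<tau>) * curvature_bound f \<tau>) \<longlongrightarrow> 0) (at_right 0)"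
    using assms by (simp add: curvature_regular_def)
  from order_tendstoD(2)[OF this, of "ereal e"]
  have "\<forall>\<^sub>F \<tau> in at_right 0. ereal (1 / \<tau>) * curvature_bound f \<tau> < ereal e"
    using \<open>0 < e\<close> by simp
  moreover have "\<forall>\<^sub>F \<tau> in at_right (0::real). 0 < \<tau>"
    by (simp add: eventually_at_right_less)
  ultimately show "\<forall>\<^sub>F \<tau> in at_right 0. curvature_bound f \<tau> \<le> ereal (e * \<tau>)"
  proof eventually_elim
    case (elim \<tau>)
    have "curvature_bound f \<tau> < \<infinity>"
      using assms \<open>0 < \<tau>\<close> by (auto simp: curvature_regular_def)
    then show ?case
      using elim curvature_bound_nonneg[of \<tau> f]
      by (cases "curvature_bound f \<tau>") (auto simp: field_simps)
  qed
qed

text \<open>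
  The gauge is an inverse of the curvature bound only at levels that are attained. Monotonicity and
  quadratic growth squeeze the bound between \<open>min 1 ((s / t)\<^sup>2)\<close> and \<open>max 1 ((s / t)\<^sup>2)\<close> times its
  value at \<open>t\<close>, so it is continuous on the positive half-line. It is small near the origin and unbounded,
  and the intermediate value theorem applies.
\<close>

lemma curvature_bound_surj:
  fixes f :: "'a::real_normed_vector \<Rightarrow> real"
  assumes f: "convex_on UNIV f" and na: "\<not> affine_function f"
    and g: "g \<in> subdifferential f 0" and reg: "curvature_regular f" and v: "0 < v"
  shows "\<exists>t\<ge>0. curvature_bound f t = ereal v"
proof -
  define m where "m t = real_of_ereal (curvature_bound f t)" for t
  have m: "curvature_bound f t = ereal (m t)" if "0 \<le> t" for t
    unfolding m_def by (rule curvature_regular_finite[OF reg that])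
  have mono: "m s \<le> m t" if "0 \<le> s" "s \<le> t" for s t
    using curvature_bound_mono[OF that(2), of f] m that by simp
  have scale: "m (c * t) \<le> c\<^sup>2 * m t" if "1 \<le> c" "0 \<le> t" for c t
    using curvature_bound_scale[OF f that(1), of t "m t"] m that by simp
  have scale': "c\<^sup>2 * m t \<le> m (c * t)" if "0 < c" "c \<le> 1" "0 \<le> t" for c t
    using scale[of "1 / c" "c * t"] that by (simp add: field_simps)
  have cont: "isCont m t" if t: "0 < t" for t
    unfolding isCont_def
  proof (rule tendsto_sandwich)
    have pos: "\<forall>\<^sub>F s in at t. 0 < s"
      using order_tendstoD(1)[OF tendsto_ident_at t] by simp
    show "\<forall>\<^sub>F s in at t. min 1 ((s / t)\<^sup>2) * m t \<le> m s"
      using pos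
    proof eventually_elim
      case (elim s)
      have "0 \<le> m t"
        using curvature_bound_nonneg[of t f] m[of t] t by simp
      show ?case
      proof (cases "s \<le> t")
        case True
        have "min 1 ((s / t)\<^sup>2) * m t \<le> (s / t)\<^sup>2 * m t"
          using \<open>0 \<le> m t\<close> by (intro mult_right_mono) auto
        then show ?thesis
          using scale'[of "s / t" t] elim t True by simp
      next
        case False
        have "min 1 ((s / t)\<^sup>2) * m t \<le> 1 * m t"
          using \<open>0 \<le> m t\<close> by (intro mult_right_mono) auto
        then show ?thesis
          using mono[of t s] t False by simp
      qed
    qed
    show "\<forall>\<^sub>F s in at t. m s \<le> max 1 ((s / t)\<^sup>2) * m t"
      using pos
    proof eventually_elim
      case (elim s)
      have "0 \<le> m t"
        using curvature_bound_nonneg[of t f] m[of t] t by simp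
      show ?case
      proof (cases "s \<le> t")
        case True
        have "1 * m t \<le> max 1 ((s / t)\<^sup>2) * m t"
          using \<open>0 \<le> m t\<close> by (intro mult_right_mono) auto
        then show ?thesis
          using mono[of s t] elim True by simp
      next
        case False
        have "(s / t)\<^sup>2 * m t \<le> max 1 ((s / t)\<^sup>2) * m t"
          using \<open>0 \<le> m t\<close> by (intro mult_right_mono) auto
        then show ?thesis
          using scale[of "s / t" t] t False by simp
      qed
    qed
    have *: "((\<lambda>s. (s / t)\<^sup>2) \<longlongrightarrow> (t / t)\<^sup>2) (at t)"
      using t by (intro tendsto_intros) auto
    have "((\<lambda>s. min 1 ((s / t)\<^sup>2) * m t) \<longlongrightarrow> min 1 ((t / t)\<^sup>2) * m t) (at t)"
      by (intro tendsto_intros *)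
    then show "((\<lambda>s. min 1 ((s / t)\<^sup>2) * m t) \<longlongrightarrow> m t) (at t)"
      using t by simp
    have "((\<lambda>s. max 1 ((s / t)\<^sup>2) * m t) \<longlongrightarrow> max 1 ((t / t)\<^sup>2) * m t) (at t)"
      by (intro tendsto_intros *)
    then show "((\<lambda>s. max 1 ((s / t)\<^sup>2) * m t) \<longlongrightarrow> m t) (at t)"
      using t by simp
  qed
  obtain b where b: "0 \<le> b" "v \<le> m b"
    using curvature_bound_unbounded[OF f na g, of v] m by auto
  obtain h where h: "0 < h" "\<And>\<tau>. 0 < \<tau> \<Longrightarrow> \<tau> < h \<Longrightarrow> curvature_bound f \<tau> \<le> ereal (1 * \<tau>)"
    using curvature_regular_sublinear[OF reg, of 1] unfolding eventually_at_right_field by auto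
  \<comment> \<open>Below \<open>h\<close> the bound is at most its argument, so it is at most \<open>v\<close> at any point below both \<open>h\<close> and \<open>v\<close>.\<close>
  define a where "a = min (h / 2) v"
  have a: "0 < a" "m a \<le> v"
    using h(1) h(2)[of a] m[of a] v by (auto simp: a_def min_def split: if_splits)
  show ?thesis
  proof (cases "a \<le> b")
    case True
    have "\<exists>t\<ge>a. t \<le> b \<and> m t = v"
      using a b True cont by (intro IVT) auto
    then obtain t where "a \<le> t" "m t = v"
      by blast
    then show ?thesis
      using a m[of t] by (intro exI[of _ t]) auto
  next
    \<comment> \<open>By monotonicity \<open>v \<le> m b \<le> m a \<le> v\<close>.\<close>
    case False
    then have "m a = v"
      using mono[of b a] a b by linarith
    then show ?thesis
      using a m[of a] by (intro exI[of _ a]) auto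
  qed
qed

lemma complexity_gauge_inverse:
  fixes f :: "'a::real_normed_vector \<Rightarrow> real"
  assumes "convex_on UNIV f" "\<not> affine_function f" "g \<in> subdifferential f 0"
    "curvature_regular f" "0 < v"
  shows "0 < complexity_gauge f v" "curvature_bound f (complexity_gauge f v) = ereal v"
proof -
  have "ereal v \<in> curvature_bound f ` {0..}"
    using curvature_bound_surj[OF assms] by (metis atLeast_iff image_eqI)
  then have "complexity_gauge f v \<in> {0..}"
    and *: "curvature_bound f (complexity_gauge f v) = ereal v"
    unfolding complexity_gauge_def by (rule inv_into_into, rule f_inv_into_f)
  show "curvature_bound f (complexity_gauge f v) = ereal v"
    by (rule *)
  then show "0 < complexity_gauge f v"
    using \<open>complexity_gauge f v \<in> {0..}\<close> \<open>0 < v\<close> curvature_bound_0[of f]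
    by (cases "complexity_gauge f v = 0") auto
qed

section \<open>Upper models of the smooth part\<close>

text \<open>
  Up to the curvature \<open>m\<close>, the increment \<open>f y - f z\<close> is at most any difference quotient of \<open>f\<close> at \<open>z\<close> in the
  direction \<open>y - z\<close>. A subgradient bounds difference quotients only from below. Since the curvature is of smaller order than the step,
  however, the second difference of \<open>f\<close> at \<open>z\<close> is negligible, and the subgradient inequality at the
  reflected point becomes an upper bound on the quotient with an arbitrarily small error.
\<close>

lemma subgradient_upper_bound:
  fixes f :: "'a::real_normed_vector \<Rightarrow> real"
  assumes reg: "curvature_regular f" and g: "g \<in> subdifferential f z"
    and gap: "gap_within f (norm (y - z)) m"
  shows "f y \<le> f z + g (y - z) + m"
proof (cases "y = z")
  case True
  have "0 \<le> m"
    using gap True curvature_bound_nonneg[of 0 f]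
    by (metis curvature_bound_le_iff dual_order.refl ereal_less_eq(5) norm_zero order_trans right_minus_eq)
  then show ?thesis
    using True by (simp add: blinfun.zero_right)
next
  case False
  define h where "h = y - z"
  have "0 < norm h"
    using False by (simp add: h_def)
  have below: "f z + g w \<le> f (z + w)" for w
    using g by (auto simp: subdifferential_def dest: spec[of _ "z + w"])
  have bound: "f y \<le> f z + g h + m + e" if e: "0 < e" for e
  proof -
    define e' where "e' = e / norm h"
    have "0 < e'"
      using e \<open>0 < norm h\<close> by (simp add: e'_def)
    then obtain b where b: "0 < b" "\<And>\<tau>. 0 < \<tau> \<Longrightarrow> \<tau> < b \<Longrightarrow> curvature_bound f \<tau> \<le> ereal (e' * \<tau>)"
      using curvature_regular_sublinear[OF reg] unfolding eventually_at_right_field by blast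
    have e'h: "e' * norm h = e"
      using \<open>0 < norm h\<close> by (simp add: e'_def)
    \<comment> \<open>Small enough for the two points \<open>z + \<alpha> *\<^sub>R h\<close> and \<open>z - \<alpha> *\<^sub>R h\<close> to be closer than \<open>b\<close>.\<close>
    define \<alpha> where "\<alpha> = min (1/2) (b / (4 * norm h))"
    have \<alpha>: "0 < \<alpha>" "\<alpha> < 1"
      using b \<open>0 < norm h\<close> by (auto simp: \<alpha>_def)
    have "\<alpha> \<le> b / (4 * norm h)"
      by (simp add: \<alpha>_def)
    then have "2 * \<alpha> * norm h < b"
      using \<open>0 < norm h\<close> b(1) by (simp add: field_simps)
    then have small: "gap_within f (2 * \<alpha> * norm h) (e' * (2 * \<alpha> * norm h))"
      using b(2)[of "2 * \<alpha> * norm h"] \<alpha> \<open>0 < norm h\<close> by (simp add: curvature_bound_le_iff)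
    have "1/2 * f (z + \<alpha> *\<^sub>R h) + (1 - 1/2) * f (z - \<alpha> *\<^sub>R h)
        - f ((1/2) *\<^sub>R (z + \<alpha> *\<^sub>R h) + (1 - 1/2) *\<^sub>R (z - \<alpha> *\<^sub>R h))
      \<le> 1/2 * (1 - 1/2) * (e' * (2 * \<alpha> * norm h))"
    proof (rule gap_withinD[OF small])
      have "(z + \<alpha> *\<^sub>R h) - (z - \<alpha> *\<^sub>R h) = (2 * \<alpha>) *\<^sub>R h"
        by (simp add: algebra_simps flip: scaleR_add_left)
      then show "norm ((z + \<alpha> *\<^sub>R h) - (z - \<alpha> *\<^sub>R h)) \<le> 2 * \<alpha> * norm h"
        using \<alpha> by simp
    qed auto
    moreover have "(1/2) *\<^sub>R (z + \<alpha> *\<^sub>R h) + (1 - 1/2) *\<^sub>R (z - \<alpha> *\<^sub>R h) = z"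
      by (simp add: algebra_simps flip: scaleR_add_left)
    moreover have "e' * (2 * \<alpha> * norm h) = 2 * (\<alpha> * e)"
      by (simp flip: e'h)
    ultimately have "f (z + \<alpha> *\<^sub>R h) + f (z - \<alpha> *\<^sub>R h) - 2 * f z \<le> \<alpha> * e"
      by simp
    moreover have "f z - \<alpha> * g h \<le> f (z - \<alpha> *\<^sub>R h)"
      using below[of "- (\<alpha> *\<^sub>R h)"] by (simp add: blinfun.minus_right blinfun.scaleR_right)
    ultimately have 1: "f (z + \<alpha> *\<^sub>R h) \<le> f z + \<alpha> * g h + \<alpha> * e"
      by simp
    have "\<alpha> *\<^sub>R y + (1 - \<alpha>) *\<^sub>R z = z + \<alpha> *\<^sub>R h"
      by (simp add: h_def algebra_simps)
    then have 2: "\<alpha> * f y + (1 - \<alpha>) * f z - f (z + \<alpha> *\<^sub>R h) \<le> \<alpha> * (1 - \<alpha>) * m"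
      using gap_withinD[OF gap \<alpha>, of y z] by simp
    have "\<alpha> * f y \<le> \<alpha> * (f z + g h + (1 - \<alpha>) * m + e)"
      using 1 2 by (simp add: algebra_simps)
    then have "f y \<le> f z + g h + (1 - \<alpha>) * m + e"
      using \<alpha> by simp
    moreover have "0 \<le> \<alpha> * m"
    proof -
      have "0 \<le> m"
        using gap curvature_bound_nonneg[of "norm (y - z)" f]
        by (metis curvature_bound_le_iff ereal_less_eq(5) norm_ge_zero order_trans)
      then show ?thesis
        using \<alpha> by simp
    qed
    ultimately show ?thesis
      by (simp add: algebra_simps)
  qed
  show ?thesis
    using bound unfolding h_def by (rule field_le_epsilon)
qed

text \<open>
  With \<open>s\<close> the gauge at \<open>\<epsilon> / 2\<close>, the curvature at distance \<open>t\<close> is at most \<open>\<epsilon> / 2\<close> for \<open>t \<le> s\<close>, by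
  monotonicity, and at most \<open>(t / s)\<^sup>2 * (\<epsilon> / 2)\<close> for \<open>t \<ge> s\<close>, by quadratic growth. The sum of both terms
  covers both cases; this is where the value \<open>\<epsilon> / s\<^sup>2\<close> of \<open>gamma_gauge\<close> comes from.
\<close>

lemma inexact_quadratic_upper_bound:
  fixes f :: "'a::real_normed_vector \<Rightarrow> real"
  assumes f: "convex_on UNIV f" and na: "\<not> affine_function f"
    and sub: "\<And>z. f' z \<in> subdifferential f z" and reg: "curvature_regular f" and "0 < \<epsilon>"
  shows "f y \<le> f z + f' z (y - z) + gamma_gauge f \<epsilon> / 2 * (norm (y - z))\<^sup>2 + \<epsilon> / 2"
proof -
  define s where "s = complexity_gauge f (\<epsilon> / 2)"
  have s: "0 < s" "curvature_bound f s = ereal (\<epsilon> / 2)"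
    using complexity_gauge_inverse[OF f na sub reg, of "\<epsilon> / 2"] \<open>0 < \<epsilon>\<close> by (auto simp: s_def)
  define c where "c = max 1 (norm (y - z) / s)"
  have "norm (y - z) \<le> c * s"
    using s by (auto simp: c_def max_def field_simps)
  then have "curvature_bound f (norm (y - z)) \<le> curvature_bound f (c * s)"
    by (rule curvature_bound_mono)
  also have "\<dots> \<le> ereal (c\<^sup>2 * (\<epsilon> / 2))"
    using s by (intro curvature_bound_scale[OF f]) (auto simp: c_def)
  finally have "f y \<le> f z + f' z (y - z) + c\<^sup>2 * (\<epsilon> / 2)"
    using subgradient_upper_bound[OF reg sub] by (simp add: curvature_bound_le_iff)
  moreover have "c\<^sup>2 \<le> 1 + (norm (y - z) / s)\<^sup>2"
    by (auto simp: c_def max_def)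
  then have "c\<^sup>2 * (\<epsilon> / 2) \<le> (1 + (norm (y - z) / s)\<^sup>2) * (\<epsilon> / 2)"
    using \<open>0 < \<epsilon>\<close> by (intro mult_right_mono) auto
  moreover have "\<dots> = gamma_gauge f \<epsilon> / 2 * (norm (y - z))\<^sup>2 + \<epsilon> / 2"
    by (simp add: gamma_gauge_def s_def power_divide field_simps)
  ultimately show ?thesis
    by linarith
qed

section \<open>Convex sets and one-sided derivatives\<close>

lemma convex_interior_segment:
  fixes Q :: "'a::real_normed_vector set"
  assumes Q: "convex Q" "x \<in> Q" "c \<in> interior Q" and e: "0 < e" "e \<le> 1"
  shows "x + e *\<^sub>R (c - x) \<in> interior Q"
proof -
  let ?h = "\<lambda>u. (1 - e) *\<^sub>R x + e *\<^sub>R u"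
  have "?h ` interior Q \<subseteq> Q"
    using Q e interior_subset[of Q] by (auto intro!: convexD[OF Q(1)])
  moreover have "open (?h ` interior Q)"
    using e by (intro open_affinity) auto
  ultimately have "?h ` interior Q \<subseteq> interior Q"
    by (rule interior_maximal)
  moreover have "?h c = x + e *\<^sub>R (c - x)"
    by (simp add: algebra_simps)
  ultimately show ?thesis
    using Q(3) by (metis image_subset_iff)
qed

lemma convex_in_segment:
  fixes Q :: "'a::real_vector set"
  assumes "convex Q" "x \<in> Q" "y \<in> Q" "0 \<le> \<tau>" "\<tau> \<le> 1"
  shows "x + \<tau> *\<^sub>R (y - x) \<in> Q"
proof -
  have "(1 - \<tau>) *\<^sub>R x + \<tau> *\<^sub>R y \<in> Q"
    using assms by (intro convexD) auto
  then show ?thesis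
    by (simp add: algebra_simps)
qed

lemma convex_on_segmentD:
  fixes h :: "'a::real_vector \<Rightarrow> real"
  assumes "convex_on Q h" "x \<in> Q" "y \<in> Q" "0 \<le> \<tau>" "\<tau> \<le> 1"
  shows "h (x + \<tau> *\<^sub>R (y - x)) \<le> h x + \<tau> * (h y - h x)"
proof -
  have "x + \<tau> *\<^sub>R (y - x) = (1 - \<tau>) *\<^sub>R x + \<tau> *\<^sub>R y"
    by (simp add: algebra_simps)
  then show ?thesis
    using convex_onD[OF assms(1) assms(4,5,2,3)] by (simp add: algebra_simps)
qed

lemma eventually_at_right_0_Ioo: "\<forall>\<^sub>F \<tau> in at_right (0::real). 0 < \<tau> \<and> \<tau> < 1"
  unfolding eventually_at_right_field by (auto intro: exI[of _ 1])

lemma directional_difference_quotient: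
  fixes d :: "'a::real_normed_vector \<Rightarrow> real"
  assumes d: "(d has_derivative D) (at x within Q)" and Q: "convex Q" "x \<in> Q" "y \<in> Q"
  shows "((\<lambda>\<tau>. (d (x + \<tau> *\<^sub>R (y - x)) - d x) / \<tau>) \<longlongrightarrow> D (y - x)) (at_right 0)"
proof -
  let ?p = "\<lambda>\<tau>::real. x + \<tau> *\<^sub>R (y - x)"
  have "?p ` {0..1} \<subseteq> Q"
    using convex_in_segment[OF Q] by auto
  then have "(d has_derivative D) (at (?p 0) within (?p ` {0..1}))"
    using has_derivative_subset[OF d] by simp
  moreover have "(?p has_derivative (\<lambda>\<tau>. \<tau> *\<^sub>R (y - x))) (at 0 within {0..1})"
    by (auto intro!: derivative_eq_intros)
  ultimately have "((\<lambda>\<tau>. d (?p \<tau>)) has_derivative (\<lambda>\<tau>. D (\<tau> *\<^sub>R (y - x)))) (at 0 within {0..1})"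
    using has_derivative_in_compose by blast
  moreover have "D (\<tau> *\<^sub>R (y - x)) = D (y - x) * \<tau>" for \<tau>
    using has_derivative_linear[OF d] by (simp add: linear_cmul)
  ultimately have "((\<lambda>\<tau>. d (?p \<tau>)) has_field_derivative D (y - x)) (at 0 within {0..1})"
    by (simp add: has_field_derivative_def)
  then show ?thesis
    by (simp add: has_field_derivative_iff at_within_Icc_at_right)
qed

section \<open>Bregman distances\<close>

text \<open>
  The strong convexity inequality is postulated at interior points only, but the base point \<open>z\<close> may
  lie on the boundary. All points of the segment towards an interior point \<open>y\<close> are interior, apart
  possibly from \<open>z\<close>. Combining the inequalities at such a point with weights \<open>1 - \<tau>\<close> and \<open>\<tau>\<close> cancels the unknown
  derivative there, and letting the point tend to \<open>z\<close> brings in the derivative at \<open>z\<close>.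
\<close>

lemma prox_function_bregman_interior:
  fixes d :: "'a::real_normed_vector \<Rightarrow> real"
  assumes prox: "prox_function Q d d'" and z: "z \<in> Q" and y: "y \<in> interior Q"
  shows "1/2 * (norm (y - z))\<^sup>2 \<le> bregman d d' z y"
proof -
  have Q: "convex Q" and yQ: "y \<in> Q"
    using prox y interior_subset by (auto simp: prox_function_def convex_on_def)
  have strong: "d u + d' u (v - u) + 1/2 * (norm (v - u))\<^sup>2 \<le> d v" if "u \<in> interior Q" "v \<in> Q" for u v
    using prox that unfolding prox_function_def by blast
  let ?w = "\<lambda>\<tau>. z + \<tau> *\<^sub>R (y - z)"
  let ?n = "(norm (y - z))\<^sup>2"
  have "d' z (y - z) \<le> d y - d z - 1/2 * (1 - 0) * ?n"
  proof (rule tendsto_le[of "at_right 0"])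
    show "((\<lambda>\<tau>. (d (?w \<tau>) - d z) / \<tau>) \<longlongrightarrow> d' z (y - z)) (at_right 0)"
      using prox z by (intro directional_difference_quotient[OF _ Q z yQ]) (auto simp: prox_function_def)
    show "((\<lambda>\<tau>. d y - d z - 1/2 * (1 - \<tau>) * ?n) \<longlongrightarrow> d y - d z - 1/2 * (1 - 0) * ?n) (at_right 0)"
      by (intro tendsto_intros)
    show "\<forall>\<^sub>F \<tau> in at_right 0. (d (?w \<tau>) - d z) / \<tau> \<le> d y - d z - 1/2 * (1 - \<tau>) * ?n"
      using eventually_at_right_0_Ioo
    proof eventually_elim
      case (elim \<tau>)
      let ?g = "d' (?w \<tau>) (y - z)"
      have w: "?w \<tau> \<in> interior Q"
        using elim by (intro convex_interior_segment[OF Q z y]) auto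
      have "d (?w \<tau>) + d' (?w \<tau>) (z - ?w \<tau>) + 1/2 * (norm (z - ?w \<tau>))\<^sup>2 \<le> d z"
        by (rule strong[OF w z])
      moreover have "z - ?w \<tau> = (- \<tau>) *\<^sub>R (y - z)"
        by simp
      ultimately have 1: "d (?w \<tau>) - \<tau> * ?g + 1/2 * (\<tau>\<^sup>2 * ?n) \<le> d z"
        by (simp only: blinfun.scaleR_right norm_scaleR power_mult_distrib power2_abs) simp
      have "d (?w \<tau>) + d' (?w \<tau>) (y - ?w \<tau>) + 1/2 * (norm (y - ?w \<tau>))\<^sup>2 \<le> d y"
        by (rule strong[OF w yQ])
      moreover have "y - ?w \<tau> = (1 - \<tau>) *\<^sub>R (y - z)"
        by (simp add: algebra_simps)
      ultimately have 2: "d (?w \<tau>) + (1 - \<tau>) * ?g + 1/2 * ((1 - \<tau>)\<^sup>2 * ?n) \<le> d y"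
        by (simp only: blinfun.scaleR_right norm_scaleR power_mult_distrib power2_abs) simp
      have "d (?w \<tau>) + \<tau> * (1/2 * (1 - \<tau>) * ?n)
        = (1 - \<tau>) * (d (?w \<tau>) - \<tau> * ?g + 1/2 * (\<tau>\<^sup>2 * ?n))
          + \<tau> * (d (?w \<tau>) + (1 - \<tau>) * ?g + 1/2 * ((1 - \<tau>)\<^sup>2 * ?n))"
        by (simp add: power2_eq_square field_simps)
      also have "\<dots> \<le> (1 - \<tau>) * d z + \<tau> * d y"
        using 1 2 elim by (intro add_mono mult_left_mono) auto
      finally have "d (?w \<tau>) - d z \<le> (d y - d z - 1/2 * (1 - \<tau>) * ?n) * \<tau>"
        by (simp add: algebra_simps)
      then show ?case
        using elim by (simp add: pos_divide_le_eq)
    qed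
  qed simp
  then show ?thesis
    by (simp add: bregman_def)
qed

text \<open>
  A boundary point \<open>y\<close> is approached along the segment towards an interior point \<open>c\<close>.
\<close>

lemma prox_function_bregman_lower_bound:
  fixes d :: "'a::real_normed_vector \<Rightarrow> real"
  assumes prox: "prox_function Q d d'" and Q_int: "interior Q \<noteq> {}" and z: "z \<in> Q" and y: "y \<in> Q"
  shows "1/2 * (norm (y - z))\<^sup>2 \<le> bregman d d' z y"
proof -
  obtain c where c: "c \<in> interior Q"
    using Q_int by blast
  have Q: "convex Q" and cQ: "c \<in> Q"
    using prox c interior_subset by (auto simp: prox_function_def convex_on_def)
  let ?w = "\<lambda>\<tau>::real. y + \<tau> *\<^sub>R (c - y)"
  have w0: "(?w \<longlongrightarrow> y) (at_right 0)"
    by (auto intro!: tendsto_eq_intros)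
  have in_int: "\<forall>\<^sub>F \<tau> in at_right 0. ?w \<tau> \<in> interior Q"
    using eventually_at_right_0_Ioo
    by eventually_elim (use convex_interior_segment[OF Q y c] in auto)
  have "continuous (at y within Q) d"
    using prox y has_derivative_continuous unfolding prox_function_def by blast
  then have d: "((\<lambda>\<tau>. d (?w \<tau>)) \<longlongrightarrow> d y) (at_right 0)"
    using continuous_within_tendsto_compose[of y Q d ?w "at_right 0"] w0 in_int interior_subset
    by (metis (mono_tags, lifting) eventually_mono subsetD)
  show ?thesis
  proof (rule tendsto_le[of "at_right 0"])
    show "((\<lambda>\<tau>. bregman d d' z (?w \<tau>)) \<longlongrightarrow> bregman d d' z y) (at_right 0)"
      unfolding bregman_def by (intro tendsto_intros d w0)
    show "((\<lambda>\<tau>. 1/2 * (norm (?w \<tau> - z))\<^sup>2) \<longlongrightarrow> 1/2 * (norm (y - z))\<^sup>2) (at_right 0)"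
      by (intro tendsto_intros w0)
    show "\<forall>\<^sub>F \<tau> in at_right 0. 1/2 * (norm (?w \<tau> - z))\<^sup>2 \<le> bregman d d' z (?w \<tau>)"
      using in_int by eventually_elim (rule prox_function_bregman_interior[OF prox z])
  qed simp
qed

text \<open>
  At a minimiser of a differentiable function plus a convex one, the first-order optimality condition
  says that \<open>- d' x\<close> is a subgradient of \<open>h\<close> relative to \<open>Q\<close>. The growth of the sum away from the minimiser
  is therefore at least the error of linearising \<open>d\<close>.
\<close>

lemma minimizer_bregman_growth:
  fixes d h :: "'a::real_normed_vector \<Rightarrow> real" and d' :: "'a \<Rightarrow> 'a \<Rightarrow>\<^sub>L real"
  assumes d: "(d has_derivative d' x) (at x within Q)" and h: "convex_on Q h"
    and x: "is_arg_min (\<lambda>u. d u + h u) (\<lambda>u. u \<in> Q) x" and z: "z \<in> Q"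
  shows "d x + h x + bregman d d' x z \<le> d z + h z"
proof -
  have Q: "convex Q" and xQ: "x \<in> Q"
    using h x by (auto simp: convex_on_def is_arg_min_def)
  have "h x - h z \<le> d' x (z - x)"
  proof (rule tendsto_lowerbound[of _ _ "at_right 0"])
    show "((\<lambda>\<tau>. (d (x + \<tau> *\<^sub>R (z - x)) - d x) / \<tau>) \<longlongrightarrow> d' x (z - x)) (at_right 0)"
      by (rule directional_difference_quotient[OF d Q xQ z])
    show "\<forall>\<^sub>F \<tau> in at_right 0. h x - h z \<le> (d (x + \<tau> *\<^sub>R (z - x)) - d x) / \<tau>"
      using eventually_at_right_0_Ioo
    proof eventually_elim
      case (elim \<tau>)
      have "x + \<tau> *\<^sub>R (z - x) \<in> Q"
        using elim by (intro convex_in_segment[OF Q xQ z]) auto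
      then have "d x + h x \<le> d (x + \<tau> *\<^sub>R (z - x)) + h (x + \<tau> *\<^sub>R (z - x))"
        using x by (auto simp: is_arg_min_def not_less)
      moreover have "h (x + \<tau> *\<^sub>R (z - x)) \<le> h x + \<tau> * (h z - h x)"
        using elim by (intro convex_on_segmentD[OF h xQ z]) auto
      ultimately have "(h x - h z) * \<tau> \<le> d (x + \<tau> *\<^sub>R (z - x)) - d x"
        by (simp add: algebra_simps)
      then show ?case
        using elim by (simp add: pos_le_divide_eq)
    qed
  qed simp
  then show ?thesis
    by (simp add: bregman_def)
qed

lemma convex_on_affine_form:
  fixes g :: "'a::real_normed_vector \<Rightarrow>\<^sub>L real"
  assumes "convex Q"
  shows "convex_on Q (\<lambda>u. a + g (u - b))"
proof (rule convex_onI)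
  fix t u v
  have "(1 - t) *\<^sub>R u + t *\<^sub>R v - b = (1 - t) *\<^sub>R (u - b) + t *\<^sub>R (v - b)"
    by (simp add: algebra_simps)
  then have "g ((1 - t) *\<^sub>R u + t *\<^sub>R v - b) = (1 - t) * g (u - b) + t * g (v - b)"
    by (simp only: blinfun.add_right blinfun.scaleR_right real_scaleR_def)
  then show "a + g ((1 - t) *\<^sub>R u + t *\<^sub>R v - b) \<le> (1 - t) * (a + g (u - b)) + t * (a + g (v - b))"
    by (simp only:) (simp add: distrib_left left_diff_distrib)
qed (rule assms)

lemma bregman_step_arg_min:
  assumes "\<exists>u. is_arg_min (psi_model f f' \<Psi> d d' M z) (\<lambda>u. u \<in> Q) u"
  shows "is_arg_min (psi_model f f' \<Psi> d d' M z) (\<lambda>u. u \<in> Q) (bregman_step f f' Q \<Psi> d d' M z)"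
  unfolding bregman_step_def arg_min_def using someI_ex[OF assms] .

text \<open>
  At this stepsize the quadratic term of the upper bound on \<open>f\<close> is absorbed by \<open>M * bregman d d' z y\<close>.
\<close>

lemma line_search_test_passes:
  fixes f :: "'a::real_normed_vector \<Rightarrow> real"
  assumes f: "convex_on UNIV f" and na: "\<not> affine_function f"
    and sub: "\<And>z. f' z \<in> subdifferential f z" and reg: "curvature_regular f" and "0 < \<epsilon>"
    and prox: "prox_function Q d d'" and Q_int: "interior Q \<noteq> {}" and z: "z \<in> Q"
    and ex: "\<exists>u. is_arg_min (psi_model f f' \<Psi> d d' M z) (\<lambda>u. u \<in> Q) u"
    and M: "gamma_gauge f \<epsilon> \<le> M" "0 \<le> M"
  shows "line_search_test f f' Q \<Psi> d d' \<epsilon> M z"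
proof -
  define y where "y = bregman_step f f' Q \<Psi> d d' M z"
  have "y \<in> Q"
    using bregman_step_arg_min[OF ex] by (simp add: y_def is_arg_min_def)
  have "f y \<le> f z + f' z (y - z) + gamma_gauge f \<epsilon> / 2 * (norm (y - z))\<^sup>2 + \<epsilon> / 2"
    by (rule inexact_quadratic_upper_bound[OF f na sub reg \<open>0 < \<epsilon>\<close>])
  also have "gamma_gauge f \<epsilon> / 2 * (norm (y - z))\<^sup>2 \<le> M * (1/2 * (norm (y - z))\<^sup>2)"
    using mult_right_mono[OF M(1), of "1/2 * (norm (y - z))\<^sup>2"] by simp
  also have "\<dots> \<le> M * bregman d d' z y"
    using prox_function_bregman_lower_bound[OF prox Q_int z \<open>y \<in> Q\<close>] M(2) by (rule mult_left_mono)
  finally show ?thesis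
    by (simp add: line_search_test_def psi_star_def psi_model_def y_def[symmetric] Let_def)
qed

section \<open>The universal dual gradient method\<close>

lemma is_arg_min_le:
  fixes h :: "'b \<Rightarrow> 'c::linorder"
  shows "is_arg_min h P u \<Longrightarrow> P v \<Longrightarrow> h u \<le> h v"
  by (auto simp: is_arg_min_def not_less)

text \<open>
  The sums over the run below range over \<open>j < k\<close>; the index \<open>0\<close> then serves as the base of the
  inductions, with empty sums.
\<close>

locale universal_dual_gradient =
  fixes f :: "'a::real_normed_vector \<Rightarrow> real" and f' :: "'a \<Rightarrow> 'a \<Rightarrow>\<^sub>L real"
    and Q :: "'a set" and \<Psi> :: "'a \<Rightarrow> real"
    and d :: "'a \<Rightarrow> real" and d' :: "'a \<Rightarrow> 'a \<Rightarrow>\<^sub>L real"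
    and \<epsilon> L0 :: real and x0 :: 'a
    and x y :: "nat \<Rightarrow> 'a" and L :: "nat \<Rightarrow> real" and \<phi> :: "nat \<Rightarrow> 'a \<Rightarrow> real" and i :: "nat \<Rightarrow> nat"
  assumes f_convex: "convex_on UNIV f" and f_not_affine: "\<not> affine_function f"
    and f_subgradient: "\<And>z. f' z \<in> subdifferential f z"
    and f_regular: "curvature_regular f"
    and \<Psi>_convex: "convex_on Q \<Psi>" and Q_interior: "interior Q \<noteq> {}"
    and prox: "prox_function Q d d'"
    and x0_in_Q: "x0 \<in> Q"
    and bregman_step_exists: "\<And>M z. M > 0 \<Longrightarrow> z \<in> Q \<Longrightarrow>
           \<exists>u. is_arg_min (psi_model f f' \<Psi> d d' M z) (\<lambda>u. u \<in> Q) u"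
    and \<epsilon>_pos: "\<epsilon> > 0" and L0_pos: "0 < L0" and L0_le: "L0 \<le> gamma_gauge f \<epsilon>"
    and run: "dgm_run f f' Q \<Psi> d d' \<epsilon> L0 x0 x y L \<phi> i"
begin

lemma run_init: "x 0 = x0" "L 0 = L0" "\<phi> 0 = bregman d d' x0"
  using run by (auto simp: dgm_run_def)

lemma run_step:
  "i k = (LEAST j. line_search_test f f' Q \<Psi> d d' \<epsilon> (2 ^ j * L k) (x k))"
  "is_arg_min (\<lambda>z. \<phi> k z + 1 / (2 ^ i k * L k) * linear_model f f' \<Psi> (x k) z)
     (\<lambda>z. z \<in> Q) (x (Suc k))"
  "y k = bregman_step f f' Q \<Psi> d d' (2 ^ i k * L k) (x k)"
  "2 * L (Suc k) = 2 ^ i k * L k"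
  "\<phi> (Suc k) z = \<phi> k z + 1 / (2 * L (Suc k)) * linear_model f f' \<Psi> (x k) z"
proof -
  have *: "i k = (LEAST j. line_search_test f f' Q \<Psi> d d' \<epsilon> (2 ^ j * L k) (x k)) \<and>
    is_arg_min (\<lambda>z. \<phi> k z + 1 / (2 ^ i k * L k) * linear_model f f' \<Psi> (x k) z)
      (\<lambda>z. z \<in> Q) (x (Suc k)) \<and>
    y k = bregman_step f f' Q \<Psi> d d' (2 ^ i k * L k) (x k) \<and>
    L (Suc k) = 2 ^ i k * L k / 2 \<and>
    \<phi> (Suc k) = (\<lambda>z. \<phi> k z + 1 / (2 * L (Suc k)) * linear_model f f' \<Psi> (x k) z)"
    using run unfolding dgm_run_def by blast
  note ** = * [THEN conjunct1] * [THEN conjunct2, THEN conjunct1]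
    * [THEN conjunct2, THEN conjunct2, THEN conjunct1]
    * [THEN conjunct2, THEN conjunct2, THEN conjunct2, THEN conjunct1]
    * [THEN conjunct2, THEN conjunct2, THEN conjunct2, THEN conjunct2]
  show "i k = (LEAST j. line_search_test f f' Q \<Psi> d d' \<epsilon> (2 ^ j * L k) (x k))"
    "is_arg_min (\<lambda>z. \<phi> k z + 1 / (2 ^ i k * L k) * linear_model f f' \<Psi> (x k) z)
       (\<lambda>z. z \<in> Q) (x (Suc k))"
    "y k = bregman_step f f' Q \<Psi> d d' (2 ^ i k * L k) (x k)"
    by (rule **)+
  show "2 * L (Suc k) = 2 ^ i k * L k"
    using **(4) by simp
  show "\<phi> (Suc k) z = \<phi> k z + 1 / (2 * L (Suc k)) * linear_model f f' \<Psi> (x k) z"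
    by (rule fun_cong[OF **(5)])
qed

lemma L_pos: "0 < L k"
proof (induction k)
  case 0
  then show ?case
    using L0_pos by (simp add: run_init)
next
  case (Suc k)
  then have "0 < 2 * L (Suc k)"
    unfolding run_step(4) by simp
  then show ?case
    by simp
qed

text \<open>
  By the choice of \<open>L (Suc k)\<close>, the trial objective accepted by the line search is the updated potential.
\<close>

lemma x_arg_min: "is_arg_min (\<phi> k) (\<lambda>z. z \<in> Q) (x k)"
proof (cases k)
  case 0
  have "0 \<le> bregman d d' x0 z" if "z \<in> Q" for z
    using prox_function_bregman_lower_bound[OF prox Q_interior x0_in_Q that]
    by (rule order_trans[rotated]) simp
  moreover have "bregman d d' x0 x0 = 0"
    by (simp add: bregman_def blinfun.zero_right)
  ultimately show ?thesis
    using 0 x0_in_Q by (auto simp: is_arg_min_def run_init not_less)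
next
  case (Suc n)
  have "\<phi> (Suc n) = (\<lambda>z. \<phi> n z + 1 / (2 ^ i n * L n) * linear_model f f' \<Psi> (x n) z)"
    by (rule ext) (simp only: run_step(4,5))
  then show ?thesis
    using run_step(2)[of n] Suc by simp
qed

lemma x_in_Q: "x k \<in> Q"
  using x_arg_min by (simp add: is_arg_min_def)

lemma potential_eq:
  "\<phi> k z = bregman d d' x0 z + (\<Sum>j<k. 1 / (2 * L (Suc j)) * linear_model f f' \<Psi> (x j) z)"
  by (induction k) (simp_all add: run_init(3) run_step(5))

lemma potential_minus_prox_convex: "convex_on Q (\<lambda>z. \<phi> k z - d z)"
proof (induction k)
  case 0
  have "convex_on Q (\<lambda>z. - d x0 + (- d' x0) (z - x0))"
    using prox by (intro convex_on_affine_form) (auto simp: prox_function_def convex_on_def)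
  then show ?case
    by (simp add: run_init bregman_def blinfun.minus_left)
next
  case (Suc k)
  have "convex_on Q (\<lambda>z. (f (x k) + f' (x k) (z - x k)) + \<Psi> z)"
    using \<Psi>_convex by (intro convex_on_add convex_on_affine_form) (auto simp: convex_on_def)
  then have "convex_on Q (linear_model f f' \<Psi> (x k))"
    by (simp add: linear_model_def[abs_def])
  then have "convex_on Q (\<lambda>z. (\<phi> k z - d z) + 1 / (2 * L (Suc k)) * linear_model f f' \<Psi> (x k) z)"
    using L_pos[of "Suc k"] by (intro convex_on_add[OF Suc] convex_on_cmul) auto
  then show ?case
    by (simp add: run_step(5) algebra_simps)
qed

text \<open>
  The potential is \<open>d\<close> plus a convex function, so it inherits from \<open>d\<close> the growth away from its minimiser.
\<close>

lemma potential_growth: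
  assumes "z \<in> Q"
  shows "\<phi> k (x k) + bregman d d' (x k) z \<le> \<phi> k z"
proof -
  have "(d has_derivative d' (x k)) (at (x k) within Q)"
    using prox x_in_Q by (simp add: prox_function_def)
  moreover have "is_arg_min (\<lambda>u. d u + (\<phi> k u - d u)) (\<lambda>u. u \<in> Q) (x k)"
    using x_arg_min by simp
  ultimately show ?thesis
    using minimizer_bregman_growth[OF _ potential_minus_prox_convex _ assms] by fastforce
qed

lemma test_passes:
  assumes "gamma_gauge f \<epsilon> \<le> M"
  shows "line_search_test f f' Q \<Psi> d d' \<epsilon> M (x k)"
proof (rule line_search_test_passes[OF f_convex f_not_affine f_subgradient f_regular \<epsilon>_pos
      prox Q_interior x_in_Q _ assms])
  have "0 < M"
    using assms L0_pos L0_le by simp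
  then show "0 \<le> M" "\<exists>u. is_arg_min (psi_model f f' \<Psi> d d' M (x k)) (\<lambda>u. u \<in> Q) u"
    using bregman_step_exists x_in_Q by auto
qed

lemma line_search_accepted: "line_search_test f f' Q \<Psi> d d' \<epsilon> (2 * L (Suc k)) (x k)"
proof -
  obtain n where "gamma_gauge f \<epsilon> / L k < 2 ^ n"
    using real_arch_pow[of 2 "gamma_gauge f \<epsilon> / L k"] by auto
  then have "gamma_gauge f \<epsilon> \<le> 2 ^ n * L k"
    using L_pos[of k] by (simp add: field_simps)
  then have "\<exists>j. line_search_test f f' Q \<Psi> d d' \<epsilon> (2 ^ j * L k) (x k)"
    using test_passes by blast
  then show ?thesis
    unfolding run_step(4) run_step(1)[of k] by (rule LeastI_ex)
qed

text \<open>
  If the line search rejects at least once, then the last rejected constant equals \<open>L (Suc k)\<close>, and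
  it is below \<open>gamma_gauge f \<epsilon>\<close> because every constant from that value on passes. If it never rejects, \<open>L\<close> is halved.
\<close>

lemma L_le_gamma: "L k \<le> gamma_gauge f \<epsilon>"
proof (induction k)
  case 0
  then show ?case
    using L0_le by (simp add: run_init)
next
  case (Suc k)
  show ?case
  proof (cases "i k")
    case 0
    then show ?thesis
      using run_step(4)[of k] Suc L_pos[of k] by simp
  next
    case (Suc n)
    then have "\<not> line_search_test f f' Q \<Psi> d d' \<epsilon> (2 ^ n * L k) (x k)"
      using run_step(1)[of k] by (intro not_less_Least) simp
    then have "2 ^ n * L k < gamma_gauge f \<epsilon>"
      using test_passes not_le by blast
    then show ?thesis
      using run_step(4)[of k] Suc by simp
  qed
qed

text \<open>
  The growth of the potential supplies the Bregman term of \<open>psi_model\<close> at \<open>x k\<close>, and the update supplies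
  the linear model with the matching weight \<open>1 / (2 * L (Suc k))\<close>. Their sum is minimised by \<open>y k\<close>, where the
  accepted test compares it with the objective.
\<close>

lemma potential_step:
  assumes z: "z \<in> Q"
  shows "\<phi> k (x k) + 1 / (2 * L (Suc k)) * (f (y k) + \<Psi> (y k) - \<epsilon> / 2) \<le> \<phi> (Suc k) z"
proof -
  define M where "M = 2 * L (Suc k)"
  have M: "0 < M"
    using L_pos by (simp add: M_def)
  have y: "y k = bregman_step f f' Q \<Psi> d d' M (x k)"
    unfolding M_def run_step(4) by (rule run_step(3))
  have "f (y k) + \<Psi> (y k) - \<epsilon> / 2 \<le> psi_model f f' \<Psi> d d' M (x k) (y k)"
    using line_search_accepted[of k]
    by (simp add: line_search_test_def psi_star_def Let_def y flip: M_def)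
  also have "\<dots> \<le> psi_model f f' \<Psi> d d' M (x k) z"
    unfolding y by (rule is_arg_min_le[OF bregman_step_arg_min[OF bregman_step_exists[OF M x_in_Q]] z])
  finally have "1 / M * (f (y k) + \<Psi> (y k) - \<epsilon> / 2) \<le> 1 / M * psi_model f f' \<Psi> d d' M (x k) z"
    using M by (intro mult_left_mono) auto
  also have "\<dots> = bregman d d' (x k) z + 1 / M * linear_model f f' \<Psi> (x k) z"
    using M by (simp add: psi_model_def linear_model_def field_simps)
  finally show ?thesis
    using potential_growth[OF z, of k] by (simp add: run_step(5) flip: M_def)
qed

lemma objective_sum_le_potential:
  "(\<Sum>j<k. 1 / (2 * L (Suc j)) * (f (y j) + \<Psi> (y j)))
     \<le> \<phi> k (x k) + (\<Sum>j<k. 1 / L (Suc j)) * (\<epsilon> / 4)"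
proof (induction k)
  case 0
  show ?case
    by (simp add: run_init bregman_def blinfun.zero_right)
next
  case (Suc k)
  have "1 / (2 * L (Suc k)) * (f (y k) + \<Psi> (y k) - \<epsilon> / 2)
    = 1 / (2 * L (Suc k)) * (f (y k) + \<Psi> (y k)) - 1 / L (Suc k) * (\<epsilon> / 4)"
    by (simp add: right_diff_distrib)
  then show ?case
    using Suc potential_step[OF x_in_Q, of k "Suc k"]
    unfolding sum.lessThan_Suc distrib_right by linarith
qed

lemma linear_model_le: "linear_model f f' \<Psi> u z \<le> f z + \<Psi> z"
  using f_subgradient[of u] by (simp add: linear_model_def subdifferential_def)

lemma potential_le:
  "\<phi> k z \<le> bregman d d' x0 z + (\<Sum>j<k. 1 / L (Suc j)) / 2 * (f z + \<Psi> z)"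
proof -
  have "(\<Sum>j<k. 1 / (2 * L (Suc j)) * linear_model f f' \<Psi> (x j) z)
    \<le> (\<Sum>j<k. 1 / (2 * L (Suc j)) * (f z + \<Psi> z))"
    using L_pos by (intro sum_mono mult_left_mono linear_model_le) (auto simp: less_imp_le)
  also have "\<dots> = (\<Sum>j<k. 1 / L (Suc j)) / 2 * (f z + \<Psi> z)"
    unfolding sum_divide_distrib sum_distrib_right by (intro sum.cong) (auto simp: mult.commute)
  finally show ?thesis
    by (simp add: potential_eq)
qed

lemma weights_ge: "real k / gamma_gauge f \<epsilon> \<le> (\<Sum>j<k. 1 / L (Suc j))"
proof -
  have "(\<Sum>j<k. 1 / gamma_gauge f \<epsilon>) \<le> (\<Sum>j<k. 1 / L (Suc j))"
    using L_pos L_le_gamma by (intro sum_mono le_imp_inverse_le[unfolded inverse_eq_divide]) auto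
  then show ?thesis
    by simp
qed

text \<open>
  The sum of objective values is bounded by the minimum of the potential, hence by the value of the
  potential at the comparison point \<open>z\<close>, which exceeds the weighted objective there by no more than
  \<open>bregman d d' x0 z\<close>.
\<close>

lemma mean_objective_le:
  assumes z: "z \<in> Q" and k: "0 < k"
  defines "S \<equiv> \<Sum>j<k. 1 / L (Suc j)"
  shows "1 / S * (\<Sum>j<k. 1 / L (Suc j) * (f (y j) + \<Psi> (y j))) - (f z + \<Psi> z)
    \<le> \<epsilon> / 2 + 2 * gamma_gauge f \<epsilon> / real k * bregman d d' x0 z"
proof -
  have gamma: "0 < gamma_gauge f \<epsilon>"
    using L0_pos L0_le by simp
  have kS: "real k / gamma_gauge f \<epsilon> \<le> S"
    unfolding S_def by (rule weights_ge)
  then have S: "0 < S"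
    using k gamma by (smt (verit) divide_pos_pos of_nat_0_less_iff)
  have b: "0 \<le> bregman d d' x0 z"
    using prox_function_bregman_lower_bound[OF prox Q_interior x0_in_Q z]
    by (rule order_trans[rotated]) simp
  have "(\<Sum>j<k. 1 / L (Suc j) * (f (y j) + \<Psi> (y j)))
    = 2 * (\<Sum>j<k. 1 / (2 * L (Suc j)) * (f (y j) + \<Psi> (y j)))"
    unfolding sum_distrib_left
    by (intro sum.cong) (simp_all add: field_simps less_imp_neq[OF L_pos, symmetric])
  also have "\<dots> \<le> 2 * (\<phi> k (x k) + S * (\<epsilon> / 4))"
    unfolding S_def by (intro mult_left_mono objective_sum_le_potential) simp
  also have "\<dots> \<le> 2 * (bregman d d' x0 z + S / 2 * (f z + \<Psi> z) + S * (\<epsilon> / 4))"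
    using is_arg_min_le[OF x_arg_min z, of k] potential_le[of k z] by (simp add: S_def)
  also have "\<dots> = S * (2 / S * bregman d d' x0 z + (f z + \<Psi> z) + \<epsilon> / 2)"
    using S by (simp add: field_simps)
  finally have "1 / S * (\<Sum>j<k. 1 / L (Suc j) * (f (y j) + \<Psi> (y j)))
    \<le> 2 / S * bregman d d' x0 z + (f z + \<Psi> z) + \<epsilon> / 2"
    using S by (simp add: divide_le_eq mult.commute)
  moreover have "2 / S \<le> 2 / (real k / gamma_gauge f \<epsilon>)"
    using kS k gamma S by (intro divide_left_mono) auto
  then have "2 / S * bregman d d' x0 z \<le> 2 * gamma_gauge f \<epsilon> / real k * bregman d d' x0 z"
    using mult_right_mono[OF _ b] by fastforce
  ultimately show ?thesis
    by linarith
qed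

end

theorem theorem5:
  fixes f :: "'a::real_normed_vector \<Rightarrow> real" and f' :: "'a \<Rightarrow> 'a \<Rightarrow>\<^sub>L real"
    and Q :: "'a set" and \<Psi> :: "'a \<Rightarrow> real"
    and d :: "'a \<Rightarrow> real" and d' :: "'a \<Rightarrow> 'a \<Rightarrow>\<^sub>L real"
    and \<epsilon> L0 :: real and x0 xstar :: 'a
    and x y :: "nat \<Rightarrow> 'a" and L :: "nat \<Rightarrow> real" and \<phi> :: "nat \<Rightarrow> 'a \<Rightarrow> real" and i :: "nat \<Rightarrow> nat"
    and S :: "nat \<Rightarrow> real" and fmean :: "nat \<Rightarrow> real" and phistar :: "nat \<Rightarrow> real"
  assumes "finite_dimensional TYPE('a)"
    and "convex_on UNIV f" and "\<not> affine_function f"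
    and "\<And>z. f' z \<in> subdifferential f z"
    and "curvature_regular f"
    and "closed_convex_function Q \<Psi>" and "interior Q \<noteq> {}"
    and "prox_function Q d d'"
    and "is_arg_min d (\<lambda>z. z \<in> Q) x0" and "d x0 = 0"
    and B_exists: "\<And>M z. M > 0 \<Longrightarrow> z \<in> Q \<Longrightarrow>
           \<exists>u. is_arg_min (psi_model f f' \<Psi> d d' M z) (\<lambda>u. u \<in> Q) u"
    and "is_arg_min (\<lambda>z. f z + \<Psi> z) (\<lambda>z. z \<in> Q) xstar"
    and "\<epsilon> > 0" and "0 < L0" and "L0 \<le> gamma_gauge f \<epsilon>"
    and "dgm_run f f' Q \<Psi> d d' \<epsilon> L0 x0 x y L \<phi> i"
    and S_def: "\<And>k. S k = (\<Sum>j=0..k. 1 / L (Suc j))"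
    and fmean_def: "\<And>k. fmean k = 1 / S k * (\<Sum>j=0..k. 1 / L (Suc j) * (f (y j) + \<Psi> (y j)))"
    and phistar_def: "\<And>k. phistar k = (INF z\<in>Q. \<phi> k z)"
  shows "(\<forall>k. is_arg_min (\<phi> k) (\<lambda>z. z \<in> Q) (x k) \<and> phistar k = \<phi> k (x k)) \<and>
    (\<forall>k. L k \<le> gamma_gauge f \<epsilon>) \<and>
    (\<forall>k. (\<Sum>j=0..k. 1 / (2 * L (Suc j)) * (f (y j) + \<Psi> (y j)))
           \<le> phistar (Suc k) + S k * (\<epsilon> / 4)) \<and>
    (\<forall>k. fmean k - (f xstar + \<Psi> xstar)
           \<le> \<epsilon> / 2 + 2 * gamma_gauge f \<epsilon> / (real k + 1) * bregman d d' x0 xstar)"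
proof -
  have "xstar \<in> Q"
    using assms(12) by (simp add: is_arg_min_def)
  interpret universal_dual_gradient f f' Q \<Psi> d d' \<epsilon> L0 x0 x y L \<phi> i
    using assms by unfold_locales (auto simp: closed_convex_function_def is_arg_min_def[of d])
  have star: "phistar k = \<phi> k (x k)" for k
    unfolding phistar_def using x_in_Q is_arg_min_le[OF x_arg_min]
    by (intro cInf_eq_minimum) auto
  have S: "S k = (\<Sum>j<Suc k. 1 / L (Suc j))" for k
    by (simp add: S_def atLeast0AtMost lessThan_Suc_atMost)
  have "(\<Sum>j=0..k. 1 / (2 * L (Suc j)) * (f (y j) + \<Psi> (y j)))
      \<le> phistar (Suc k) + S k * (\<epsilon> / 4)" for k
    using objective_sum_le_potential[of "Suc k"] unfolding star S
    by (simp only: atLeast0AtMost lessThan_Suc_atMost)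
  moreover have "fmean k - (f xstar + \<Psi> xstar)
      \<le> \<epsilon> / 2 + 2 * gamma_gauge f \<epsilon> / (real k + 1) * bregman d d' x0 xstar" for k
    using mean_objective_le[OF \<open>xstar \<in> Q\<close>, of "Suc k"] unfolding fmean_def S
    by (simp add: atLeast0AtMost lessThan_Suc_atMost add.commute)
  ultimately show ?thesis
    using x_arg_min star L_le_gamma by blast
qed

end
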